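(* Let $S$ be an Arf numerical semigroup with multiplicity $4$ and conductor $c$. (i) If $c\equiv 0\pmod 4$, then $S=\langle 4,4t+2,c+1,c+3\rangle$ for some $t\in\{1,\ldots,\frac c4\}$. (ii) If $c\equiv 2\pmod 4$, then $S=\langle 4,4t+2,c+1,c+3\rangle$ for some $t\in\{1,\ldots,\frac{c-2}4\}$. (iii) If $c\equiv 3\pmod 4$, then $S=\langle 4,c,c+2,c+3\rangle$.
   Context: A numerical semigroup is a submonoid $S$ of $(\mathbb N,+)$ ($\mathbb N$ the nonnegative integers) with finite complement in $\mathbb N$. Its multiplicity is the least positive integer in $S$, and its conductor is $\max(\mathbb Z\setminus S)+1$. $S$ is an Arf numerical semigroup if $x+y-z\in S$ for all $x,y,z\in S$ with $x\ge y\ge z$. $\langle A\rangle$ denotes the submonoid of $\mathbb N$ generated by $A$. *)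

theory Defs
  imports "HOL-Number_Theory.Cong" "HOL.Hull"
begin

definition nat_submonoid :: "nat set \<Rightarrow> bool" where
  "nat_submonoid S \<longleftrightarrow> 0 \<in> S \<and> (\<forall>x\<in>S. \<forall>y\<in>S. x + y \<in> S)"

definition submonoid_generated :: "nat set \<Rightarrow> nat set" where
  "submonoid_generated A = nat_submonoid hull A"

definition numerical_semigroup :: "nat set \<Rightarrow> bool" where
  "numerical_semigroup S \<longleftrightarrow> nat_submonoid S \<and> finite (- S)"

definition semigroup_multiplicity :: "nat set \<Rightarrow> nat" where
  "semigroup_multiplicity S = (LEAST n. n \<in> S \<and> n > 0)"

(* The maximum is taken over the integers, where all negative numbers lie outside S. So for a
   numerical semigroup it exists and is at least -1, and the conversion to nat loses nothing.
   Max is not applicable because the set is infinite. *)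
definition conductor :: "nat set \<Rightarrow> nat" where
  "conductor S = nat ((GREATEST z :: int. z \<notin> int ` S) + 1)"

(* The natural-number subtraction does not truncate, since z is at most y. *)
definition arf_numerical_semigroup :: "nat set \<Rightarrow> bool" where
  "arf_numerical_semigroup S \<longleftrightarrow>
     numerical_semigroup S \<and>
     (\<forall>x\<in>S. \<forall>y\<in>S. \<forall>z\<in>S. x \<ge> y \<and> y \<ge> z \<longrightarrow> x + y - z \<in> S)"

end

(* Subtracting multiples of 4 via the Arf property shows that an element s of S puts further residue
   classes into S just above s: s = 1 (mod 4) gives s + 1, s = 3 gives s + 3, and odd s gives s + 2.
   As c - 1 is a gap, so is every smaller number congruent to it, which leaves no odd elements
   below c. Only the position 4t + 2 of the least element congruent to 2 stays free. *)

theory Submission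
  imports Defs
begin

section \<open>Submonoids of the natural numbers and their generators\<close>

text \<open>Trades the greatest integer outside \<open>S\<close> for the maximum of a finite set of
  naturals. Excluding \<open>UNIV\<close> makes that set nonempty; for \<open>UNIV\<close> the
  integer maximum would be -1.\<close>

lemma numerical_semigroup_conductor:
  assumes "numerical_semigroup S" "S \<noteq> UNIV"
  shows "conductor S = Suc (Max (- S))"
proof -
  have fin: "finite (- S)" and ne: "- S \<noteq> {}"
    using assms by (auto simp: numerical_semigroup_def)
  have "(GREATEST z :: int. z \<notin> int ` S) = int (Max (- S))"
  proof (rule Greatest_equality)
    show "int (Max (- S)) \<notin> int ` S"
      using Max_in[OF fin ne] by auto
  next
    fix z :: int
    assume z: "z \<notin> int ` S"
    show "z \<le> int (Max (- S))"
    proof (cases "z < 0")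
      case False
      then have "nat z \<in> - S" using z by (metis ComplI imageI int_nat_eq not_less)
      then have "nat z \<le> Max (- S)" using fin by simp
      then show ?thesis by linarith
    qed linarith
  qed
  then show ?thesis by (simp add: conductor_def)
qed

lemma nat_submonoid_add_mult:
  assumes "nat_submonoid S" "m \<in> S" "g \<in> S"
  shows "g + m * k \<in> S"
proof (induction k)
  case (Suc k)
  then have "(g + m * k) + m \<in> S" using assms by (auto simp: nat_submonoid_def)
  then show ?case by (simp add: algebra_simps)
qed (use assms in simp)

text \<open>The difference \<open>n - g\<close> is a multiple of \<open>m\<close>, so
  \<open>n\<close> is reached from \<open>g\<close> by adding \<open>m\<close> repeatedly.\<close>

lemma nat_submonoid_cong_ge:
  assumes "nat_submonoid S" "m \<in> S" "g \<in> S" "g \<le> n" "n mod m = g mod m"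
  shows "n \<in> S"
proof -
  have "m dvd n - g" using assms mod_eq_dvd_iff_nat by metis
  then obtain k where "n = g + m * k" using \<open>g \<le> n\<close> by (metis dvdE le_add_diff_inverse)
  then show ?thesis using nat_submonoid_add_mult assms by simp
qed

lemma nat_submonoid_generated: "nat_submonoid (submonoid_generated A)"
  unfolding submonoid_generated_def
  by (rule hull_in) (auto simp: nat_submonoid_def)

lemma submonoid_generated_superset: "A \<subseteq> submonoid_generated A"
  unfolding submonoid_generated_def by (rule hull_subset)

text \<open>One inclusion is minimality of the hull. For the other, climbing in steps of
  \<open>m\<close> from some \<open>g\<close> in \<open>A\<close>, or from 0 for multiples of
  \<open>m\<close>, reaches every element of \<open>S\<close>.\<close>

lemma eq_submonoid_generatedI:
  assumes "nat_submonoid S" "A \<subseteq> S" "m \<in> A"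
    and repr: "\<And>n. n \<in> S \<Longrightarrow> m dvd n \<or> (\<exists>g\<in>A. g \<le> n \<and> n mod m = g mod m)"
  shows "S = submonoid_generated A"
proof
  show "submonoid_generated A \<subseteq> S"
    unfolding submonoid_generated_def using assms by (intro hull_minimal)
  show "S \<subseteq> submonoid_generated A"
  proof
    fix n assume "n \<in> S"
    have "0 \<in> submonoid_generated A"
      using nat_submonoid_generated by (simp add: nat_submonoid_def)
    then obtain g where "g \<in> submonoid_generated A" "g \<le> n" "n mod m = g mod m"
      using repr[OF \<open>n \<in> S\<close>] submonoid_generated_superset[of A] by force
    then show "n \<in> submonoid_generated A"
      using nat_submonoid_cong_ge[OF nat_submonoid_generated] submonoid_generated_superset \<open>m \<in> A\<close>
      by blast
  qed
qed

lemma odd_mod_four_cases: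
  fixes m n :: nat
  assumes "odd m" "odd n"
  shows "n mod 4 = m mod 4 \<or> n mod 4 = (m + 2) mod 4"
proof -
  have *: "k mod 4 = 1 \<or> k mod 4 = 3" if "odd k" for k :: nat using that by presburger
  have "m mod 4 = 1 \<Longrightarrow> (m + 2) mod 4 = 3" "m mod 4 = 3 \<Longrightarrow> (m + 2) mod 4 = 1" by presburger+
  then show ?thesis using *[OF assms(1)] *[OF assms(2)] by auto
qed

section \<open>Arf semigroups of multiplicity four\<close>

context
  fixes S :: "nat set"
  assumes arf: "arf_numerical_semigroup S"
    and mult: "semigroup_multiplicity S = 4"
begin

lemma submonoid: "nat_submonoid S"
  using arf by (simp add: arf_numerical_semigroup_def numerical_semigroup_def)

lemma finite_gaps: "finite (- S)"
  using arf by (simp add: arf_numerical_semigroup_def numerical_semigroup_def)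

lemma not_mem_less_four: "0 < n \<Longrightarrow> n < 4 \<Longrightarrow> n \<notin> S"
  using mult not_less_Least[of n "\<lambda>n. n \<in> S \<and> n > 0"]
  by (auto simp: semigroup_multiplicity_def)

lemma conductor_eq: "conductor S = Suc (Max (- S))"
  \<comment> \<open>1 is a gap, so \<open>S\<close> is not \<open>UNIV\<close>.\<close>
  using arf not_mem_less_four[of 1]
  by (intro numerical_semigroup_conductor) (auto simp: arf_numerical_semigroup_def)

lemma conductor_le_mem: "conductor S \<le> n \<Longrightarrow> n \<in> S"
  using Max_ge[OF finite_gaps, of n] conductor_eq by (metis ComplI not_less_eq_eq)

lemma four_mem: "4 \<in> S"
proof -
  have "\<exists>n. n \<in> S \<and> n > 0" using conductor_le_mem[of "Suc (conductor S)"] by auto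
  from LeastI_ex[OF this] show ?thesis using mult by (simp add: semigroup_multiplicity_def)
qed

lemma cong_ge_mem: "g \<in> S \<Longrightarrow> g \<le> n \<Longrightarrow> n mod 4 = g mod 4 \<Longrightarrow> n \<in> S"
  using nat_submonoid_cong_ge[OF submonoid four_mem] .

lemma four_dvd_mem: "4 dvd n \<Longrightarrow> n \<in> S"
  using cong_ge_mem[of 0 n] submonoid by (simp add: nat_submonoid_def mod_eq_0_iff_dvd)

text \<open>The Arf condition in the case x = y, the only instance that the proof uses.\<close>

lemma arf_mem: "x \<in> S \<Longrightarrow> z \<in> S \<Longrightarrow> z \<le> x \<Longrightarrow> 2 * x - z \<in> S"
  using arf by (metis arf_numerical_semigroup_def mult_2 order_refl)

text \<open>Reflects in \<open>s\<close> the largest multiple of 4 that is at most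
  \<open>s\<close>.\<close>

lemma add_residue_mem:
  assumes "s \<in> S"
  shows "s + s mod 4 \<in> S"
proof -
  have "4 dvd s - s mod 4" by (simp add: minus_mod_eq_mult_div)
  then have "2 * s - (s - s mod 4) \<in> S"
    by (intro arf_mem assms four_dvd_mem) simp_all
  moreover have "2 * s - (s - s mod 4) = s + s mod 4"
    using mod_less_eq_dividend[of s 4] by linarith
  ultimately show ?thesis by simp
qed

text \<open>In both odd classes \<open>s + 1\<close> lies in \<open>S\<close>, and the Arf condition
  gives 2(s + 1) - s = s + 2.\<close>

lemma odd_add_two_mem:
  assumes "s \<in> S" "odd s"
  shows "s + 2 \<in> S"
proof -
  have "s mod 4 = 1 \<or> s mod 4 = 3" using \<open>odd s\<close> by presburger
  then have "s + 1 \<in> S"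
  proof
    assume "s mod 4 = 1"
    then show ?thesis using add_residue_mem[OF assms(1)] by simp
  next
    assume "s mod 4 = 3"
    then have "4 dvd s + 1" by presburger
    then show ?thesis by (rule four_dvd_mem)
  qed
  from arf_mem[OF this assms(1)] show ?thesis by simp
qed

lemma conductor_minus_one_not_mem: "conductor S - 1 \<notin> S"
proof -
  have "Max (- S) \<in> - S"
    using not_mem_less_four[of 1] by (intro Max_in finite_gaps) auto
  then show ?thesis by (simp add: conductor_eq)
qed

text \<open>A member of this class below the conductor would force \<open>conductor S - 1\<close>
  into \<open>S\<close> by adding fours.\<close>

lemma gap_below_conductor:
  "n < conductor S \<Longrightarrow> n mod 4 = (conductor S - 1) mod 4 \<Longrightarrow> n \<notin> S"
  using cong_ge_mem[of n "conductor S - 1"] conductor_minus_one_not_mem by fastforce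

lemma least_mem_two_mod_four:
  obtains t where "t \<ge> 1" "4 * t + 2 \<in> S" "\<And>n. n \<in> S \<Longrightarrow> n mod 4 = 2 \<Longrightarrow> 4 * t + 2 \<le> n"
proof -
  define t where "t = (LEAST t. 4 * t + 2 \<in> S)"
  have mem: "4 * t + 2 \<in> S"
    \<comment> \<open>Some such \<open>t\<close> exists because 4c + 2 is at least c for the
      conductor c.\<close>
    unfolding t_def by (rule LeastI[of _ "conductor S"]) (simp add: conductor_le_mem)
  show thesis
  proof
    show "t \<ge> 1" using mem not_mem_less_four[of 2] by (cases "t = 0") (simp_all flip: numeral_2_eq_2)
    show "4 * t + 2 \<in> S" by (rule mem)
  next
    fix n assume "n \<in> S" "n mod 4 = 2"
    then have n: "n = 4 * (n div 4) + 2" by presburger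
    then have "t \<le> n div 4"
      unfolding t_def using \<open>n \<in> S\<close> by (intro Least_le) simp
    then show "4 * t + 2 \<le> n" using n by linarith
  qed
qed

section \<open>Even conductor\<close>

text \<open>For an odd member \<open>s\<close> below the conductor c, one of \<open>s\<close> and
  \<open>s + 2\<close> shares the residue of the odd gap c - 1.\<close>

lemma odd_mem_ge_even_conductor:
  assumes "even (conductor S)" "s \<in> S" "odd s"
  shows "conductor S \<le> s"
proof (rule ccontr)
  let ?c = "conductor S"
  assume "\<not> ?c \<le> s"
  then have s: "s < ?c" by simp
  have ne: "s mod 4 \<noteq> (?c - 1) mod 4" using gap_below_conductor[OF s] \<open>s \<in> S\<close> by blast
  have "odd (?c - 1)" using assms(1) s by simp
  then have "(s + 2) mod 4 = (?c - 1) mod 4"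
    using odd_mod_four_cases[OF \<open>odd s\<close>] ne by metis
  moreover have "s + 2 < ?c"
  proof -
    \<comment> \<open>The two values of \<open>s\<close> just below \<open>?c\<close> are excluded,
      one by its residue, the other by parity.\<close>
    have "s \<noteq> ?c - 1" using ne by auto
    moreover have "s + 2 \<noteq> ?c" using assms(1,3) by (metis even_add even_numeral)
    ultimately show ?thesis using s by linarith
  qed
  ultimately show False using gap_below_conductor odd_add_two_mem assms by blast
qed

text \<open>Treats both even residues at once; only the bound on \<open>t\<close> differs. If 4 does
  not divide an even conductor, it is at least 2, so the subtraction is exact.\<close>

lemma even_conductor_generated:
  assumes even: "even (conductor S)"
  shows "\<exists>t\<in>{1..(if 4 dvd conductor S then conductor S else conductor S - 2) div 4}.
    S = submonoid_generated {4, 4 * t + 2, conductor S + 1, conductor S + 3}"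
proof -
  let ?c = "conductor S"
  obtain t where t: "t \<ge> 1" "4 * t + 2 \<in> S" "\<And>n. n \<in> S \<Longrightarrow> n mod 4 = 2 \<Longrightarrow> 4 * t + 2 \<le> n"
    using least_mem_two_mod_four by blast
  \<comment> \<open>This is the least number from \<open>?c\<close> on that is 2 mod 4. It lies in
    \<open>S\<close>, so minimality of \<open>4 * t + 2\<close> bounds \<open>t\<close>.\<close>
  have "(if 4 dvd ?c then ?c + 2 else ?c) mod 4 = 2"
    using even by (cases "4 dvd ?c") (simp, presburger)+
  then have "4 * t + 2 \<le> (if 4 dvd ?c then ?c + 2 else ?c)"
    by (intro t(3) conductor_le_mem) simp_all
  then have "t \<le> (if 4 dvd ?c then ?c else ?c - 2) div 4"
    by (auto split: if_splits)
  moreover have "S = submonoid_generated {4, 4 * t + 2, ?c + 1, ?c + 3}"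
  proof (rule eq_submonoid_generatedI[where m = 4, OF submonoid])
    show "{4, 4 * t + 2, ?c + 1, ?c + 3} \<subseteq> S"
      using four_mem t(2) conductor_le_mem by simp
  next
    fix n assume n: "n \<in> S"
    have "4 dvd n \<or> n mod 4 = 2 \<or> odd n" by presburger
    then consider "4 dvd n" | "n mod 4 = 2" | "odd n" by blast
    then show "4 dvd n \<or> (\<exists>g\<in>{4, 4 * t + 2, ?c + 1, ?c + 3}. g \<le> n \<and> n mod 4 = g mod 4)"
    proof cases
      case 2
      moreover have "(4 * t + 2) mod 4 = 2" by presburger
      ultimately show ?thesis using t(3)[OF n] by fastforce
    next
      case 3
      then have le: "?c \<le> n" by (rule odd_mem_ge_even_conductor[OF even n])
      \<comment> \<open>By parity \<open>n\<close> cannot fall between the generators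
        \<open>?c + 1\<close> and \<open>?c + 3\<close>, which represent both odd classes.\<close>
      have "n \<noteq> ?c" "n \<noteq> ?c + 2" using even \<open>odd n\<close> by auto
      then have "n = ?c + 1 \<or> ?c + 3 \<le> n" using le by linarith
      moreover have "n mod 4 = (?c + 1) mod 4 \<or> n mod 4 = (?c + 3) mod 4"
        using odd_mod_four_cases[of "?c + 1" n] even \<open>odd n\<close> by (simp add: add.commute)
      ultimately have "?c + 1 \<le> n \<and> n mod 4 = (?c + 1) mod 4 \<or>
          ?c + 3 \<le> n \<and> n mod 4 = (?c + 3) mod 4"
        by auto
      then show ?thesis by blast
    qed simp
  qed simp
  ultimately show ?thesis using t(1) by auto
qed

section \<open>Conductor congruent to 3\<close>

text \<open>Here c - 1 is 2 mod 4, so that class has no members below c. An odd member below c would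
  produce one, so only multiples of 4 remain there.\<close>

lemma conductor_three_mod_four_generated:
  assumes c: "conductor S mod 4 = 3"
  shows "S = submonoid_generated {4, conductor S, conductor S + 2, conductor S + 3}"
proof (rule eq_submonoid_generatedI[where m = 4, OF submonoid])
  let ?c = "conductor S"
  show "{4, ?c, ?c + 2, ?c + 3} \<subseteq> S"
    using four_mem conductor_le_mem by simp
  obtain k where k: "?c = 4 * k + 3" using c by (metis mult_div_mod_eq)
  have residues: "(?c + 1) mod 4 = 0" "(?c + 2) mod 4 = 1" "(?c + 3) mod 4 = 2"
    unfolding k by presburger+
  have pred_eq: "?c - 1 = 4 * k + 2" using k by simp
  have pred: "(?c - 1) mod 4 = 2" unfolding pred_eq by presburger
  fix n assume n: "n \<in> S"
  have "n mod 4 < 4" by simp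
  then consider (0) "n mod 4 = 0" | (1) "n mod 4 = 1" | (2) "n mod 4 = 2" | (3) "n mod 4 = 3"
    by linarith
  note n_cases = this
  show "4 dvd n \<or> (\<exists>g\<in>{4, ?c, ?c + 2, ?c + 3}. g \<le> n \<and> n mod 4 = g mod 4)"
  proof (cases "?c \<le> n")
    case True
    \<comment> \<open>\<open>?c + 1\<close> is a multiple of 4; from \<open>?c + 3\<close> on, every
      generator next to 4 is small enough to represent its class.\<close>
    then have "n = ?c \<or> n = ?c + 1 \<or> n = ?c + 2 \<or> ?c + 3 \<le> n" by linarith
    then show ?thesis
    proof (elim disjE)
      assume "?c + 3 \<le> n"
      then show ?thesis using True residues c by (cases rule: n_cases) auto
    qed (use residues in auto)
  next
    case False
    then have less: "n < 4 * k + 3" using k by simp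
    have two: "m mod 4 \<noteq> 2" if "m \<in> S" "m < ?c" for m
      using gap_below_conductor[OF that(2)] that(1) pred by auto
    show ?thesis
    proof (cases rule: n_cases)
      case 1
      then obtain a where a: "n = 4 * a + 1" by (metis mult_div_mod_eq)
      \<comment> \<open>The bound is tight: for a = k, \<open>n + 1\<close> is the gap c - 1
        itself.\<close>
      then have "a < k + 1" using less by linarith
      then have "n + 1 < ?c" unfolding a k by linarith
      moreover have "(n + 1) mod 4 = 2" unfolding a by presburger
      ultimately show ?thesis using two[of "n + 1"] add_residue_mem[OF n] 1 by simp
    next
      case 2
      then show ?thesis using two[OF n] less k by simp
    next
      case 3
      then obtain a where a: "n = 4 * a + 3" by (metis mult_div_mod_eq)
      \<comment> \<open>Since \<open>?c\<close> is itself 3 mod 4, \<open>n\<close> is at most c -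
        4, so \<open>n + 3\<close> is at most c - 1.\<close>
      then have "a < k" using less by linarith
      then have "n + 3 < ?c" unfolding a k by linarith
      moreover have "(n + 3) mod 4 = 2" unfolding a by presburger
      ultimately show ?thesis using two[of "n + 3"] add_residue_mem[OF n] 3 by simp
    qed (simp add: mod_eq_0_iff_dvd)
  qed
qed simp

end

theorem proposition18:
  fixes S :: "nat set" and c :: nat
  assumes "arf_numerical_semigroup S"
    and "semigroup_multiplicity S = 4"
    and "conductor S = c"
  shows "([c = 0] (mod 4) \<longrightarrow>
            (\<exists>t\<in>{1..c div 4}. S = submonoid_generated {4, 4 * t + 2, c + 1, c + 3}))
       \<and> ([c = 2] (mod 4) \<longrightarrow>
            (\<exists>t\<in>{1..(c - 2) div 4}. S = submonoid_generated {4, 4 * t + 2, c + 1, c + 3}))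
       \<and> ([c = 3] (mod 4) \<longrightarrow>
            S = submonoid_generated {4, c, c + 2, c + 3})"
proof (intro conjI impI)
  assume "[c = 0] (mod 4)"
  then have "4 dvd c" "even c" by (simp add: cong_def, presburger)+
  then show "\<exists>t\<in>{1..c div 4}. S = submonoid_generated {4, 4 * t + 2, c + 1, c + 3}"
    using even_conductor_generated[OF assms(1,2)] assms(3) by simp
next
  assume "[c = 2] (mod 4)"
  then have "\<not> 4 dvd c" "even c" by (simp add: cong_def, presburger)+
  then show "\<exists>t\<in>{1..(c - 2) div 4}. S = submonoid_generated {4, 4 * t + 2, c + 1, c + 3}"
    using even_conductor_generated[OF assms(1,2)] assms(3) by simp
next
  assume "[c = 3] (mod 4)"
  then show "S = submonoid_generated {4, c, c + 2, c + 3}"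
    using conductor_three_mod_four_generated[OF assms(1,2)] assms(3) by (simp add: cong_def)
qed

end
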